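(* Let $p>3$ be an odd prime. Then $$\sum_{k=0}^{p-1}(8k-1)\frac{(\frac{1}{2})_k(-\frac{1}{4})_k^5}{(\frac{1}{4})_k\,k!^5}\equiv\begin{cases}0 \pmod{p^3}, &\text{if }p\equiv 1\pmod{4},\\[5pt] \dfrac{5p(p-3)(\frac{1}{2})_{(p+1)/4}^2}{(7p-3)\,((p+1)/4)!^2} \pmod{p^3},&\text{if }p\equiv 3\pmod{4}.\end{cases}$$
   Context: $(x)_k=x(x+1)\cdots(x+k-1)$, with $(x)_0=1$, is the Pochhammer symbol; $(x)_k^s$ denotes the $s$-th power of $(x)_k$, and $k!^s$ the $s$-th power of $k!$. For rational numbers $A,B$, $A\equiv B\pmod{p^3}$ means that the numerator of $A-B$, in lowest terms, is divisible by $p^3$. *)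

theory Defs
  imports Complex_Main "HOL-Computational_Algebra.Primes"
begin

(* quotient_of returns the pair (numerator, denominator) in lowest terms,
   with positive denominator. *)
definition rat_cong :: "rat \<Rightarrow> rat \<Rightarrow> int \<Rightarrow> bool" where
  "rat_cong A B m \<longleftrightarrow> m dvd fst (quotient_of (A - B))"

end

theory Submission
  imports Defs
begin

text \<open>
  Up to sign, the summand is that of a very-well-poised $_7F_6(1)$ with $a = -1/4$, whose other
  numerator parameters are $1/2$ and four copies of $-1/4$. This series does not terminate by
  itself, but a $p$-adically close one does, and that one can be summed. Let $q \in \{p, 3p\}$ be the multiple of $p$ with
  $q \equiv 3 \pmod 4$, and let $m = (q+1)/4 < p$. In every term replace $(-1/4)_k^4 / k!^4$ by
  $$\prod_{j<k} \frac{(j-1/4)^4 - (q/4)^4}{(j+1)^4 - (q/4)^4}.$$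
  This changes the product by a multiple of $p^4$. The other factors of a term contain at most one
  $p$ in the denominator, because for $j < p$ the numbers $4j+1$ are less than $p^2$ and only one of
  them is divisible by $p$. Hence the sum changes by a multiple of $p^3$ (\<open>sum_rcong_closed_form\<close>).

  Since $y^4 - (q/4)^4 = (y - q/4)(y + q/4)(y^2 + (q/4)^2)$, the new summand is again very-well-poised:
  two of the parameters $-1/4$ have become $-1/4 \pm q/4$, and the other two have become
  $-1/4 \pm iq/4$. The first two are $-m$ and $m - 1/2$, so the new sum terminates. The last two only
  occur through the square $t = -(q/4)^2$ of their distance from $-1/4$, so everything stays rational.
  With $t$ as a free parameter, the terminating sum is a product times a rational function of $m$
  and $t$ (\<open>vwp_moments\<close>); at $t = -(q/4)^2$ it equals
  $$\frac{5q}{(q-1)^2 + q^2} \prod_{j<m} \frac{(j+1/2)^2 + (q/4)^2}{(j+1)^2 + (q/4)^2}.$$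

  If $p \equiv 1 \pmod 4$, then $q = 3p$, and the factor with $2j + 1 = p$ has numerator
  $13p^2/16$, which together with $q$ gives $p^3$. If $p \equiv 3 \pmod 4$, then $q = p$, so that the
  two other factors are only needed modulo $p^2$. There the product is $(1/2)_m^2 / m!^2$, and
  $1/(1 - 2p + 2p^2) \equiv (p-3)/(7p-3)$.
\<close>

section \<open>A terminating very-well-poised sum\<close>

text \<open>
  The series for $a = -1/4$ without its very-well-poised factor $8k - 1$.
  The parameters are grouped so that the conjugate pair $-1/4 \pm s$ enters through $t = s^2$ only.
  With $y = 1/2 - x$ the numerator parameters $-x, -y$ also add up to $-1/2$, and
  $x = m$ makes the series stop after $k = m$.
\<close>

definition vwp_term :: "rat \<Rightarrow> rat \<Rightarrow> rat \<Rightarrow> nat \<Rightarrow> rat" where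
  "vwp_term t x y k = (\<Prod>j<k.
     ((of_nat j + 1/2) * (of_nat j - 1/4) * ((of_nat j - 1/4)^2 - t) * (of_nat j - x) * (of_nat j - y)) /
     ((of_nat j + 1/4) * (of_nat j + 1) * ((of_nat j + 1)^2 - t) * (of_nat j + 3/4 + x) * (of_nat j + 3/4 + y)))"

lemma vwp_term_Suc:
  "vwp_term t x y (Suc k) = vwp_term t x y k *
     (((of_nat k + 1/2) * (of_nat k - 1/4) * ((of_nat k - 1/4)^2 - t) * (of_nat k - x) * (of_nat k - y)) /
     ((of_nat k + 1/4) * (of_nat k + 1) * ((of_nat k + 1)^2 - t) * (of_nat k + 3/4 + x) * (of_nat k + 3/4 + y)))"
  by (simp add: vwp_term_def)

lemma vwp_term_commute: "vwp_term t x y k = vwp_term t y x k"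
  by (simp add: vwp_term_def mult_ac)

lemma vwp_term_eq_0: "n < k \<Longrightarrow> vwp_term t (of_nat n) y k = 0"
  unfolding vwp_term_def by (rule prod_zero) auto

text \<open>
  Raising a parameter changes a term by a factor linear in $\lambda_k = k(k - 1/4)$, because
  $(x+1)(x+3/4) - \lambda_k = (x+1-k)(x+3/4+k)$. Thus the terms for $m$ and for $m+1$
  are both multiples, by factors linear in $\lambda_k$, of the term with the larger value in
  each of the two parameters.
\<close>
lemma vwp_term_contiguous:
  assumes nz: "\<And>j. of_nat j + 3/4 + x \<noteq> (0::rat)"
  shows "vwp_term t x y k * ((x + 1) * (x + 3/4)) =
    vwp_term t (x + 1) y k * ((x + 1) * (x + 3/4) - of_nat k * (of_nat k - 1/4))"
proof (induction k)
  case 0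
  show ?case by (simp add: vwp_term_def)
next
  case (Suc k)
  define K where "K = (of_nat k :: rat)"
  define c where "c = (K + 1/2) * (K - 1/4) * ((K - 1/4)^2 - t) * (K - y) /
     ((K + 1/4) * (K + 1) * ((K + 1)^2 - t) * (K + 3/4 + y))"
  have n1: "K + 3/4 + x \<noteq> 0" using nz[of k] by (simp add: K_def)
  have n2: "K + 3/4 + (x + 1) \<noteq> 0" using nz[of "Suc k"] by (simp add: K_def algebra_simps)
  have s: "vwp_term t x' y (Suc k) = vwp_term t x' y k * c * ((K - x') / (K + 3/4 + x'))" for x'
    by (simp add: vwp_term_Suc c_def K_def mult_ac)
  have "vwp_term t x y (Suc k) * ((x + 1) * (x + 3/4)) =
     (vwp_term t x y k * ((x + 1) * (x + 3/4))) * c * ((K - x) / (K + 3/4 + x))"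
    by (simp add: s)
  also have "\<dots> = vwp_term t (x + 1) y k * c * (((x + 1) * (x + 3/4) - K * (K - 1/4)) * ((K - x) / (K + 3/4 + x)))"
    unfolding Suc K_def by (simp add: mult_ac)
  also have "((x + 1) * (x + 3/4) - K * (K - 1/4)) * ((K - x) / (K + 3/4 + x)) =
     ((K - (x + 1)) / (K + 3/4 + (x + 1))) * ((x + 1) * (x + 3/4) - (K + 1) * ((K + 1) - 1/4))"
  proof -
    have "(x + 1) * (x + 3/4) - K * (K - 1/4) = (x + 1 - K) * (K + 3/4 + x)"
      "(x + 1) * (x + 3/4) - (K + 1) * ((K + 1) - 1/4) = (x - K) * (K + 3/4 + (x + 1))"
      by (simp_all add: field_simps)
    then have "((x + 1) * (x + 3/4) - K * (K - 1/4)) * ((K - x) / (K + 3/4 + x)) = (x + 1 - K) * (K - x)"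
      "((K - (x + 1)) / (K + 3/4 + (x + 1))) * ((x + 1) * (x + 3/4) - (K + 1) * ((K + 1) - 1/4)) = (K - (x + 1)) * (x - K)"
      using n1 n2 by simp_all
    then show ?thesis by (simp add: algebra_simps)
  qed
  finally show ?case unfolding s by (simp add: K_def mult_ac add_ac)
qed

text \<open>
  The two products are the numerator of the term ratio at $k$ and its denominator at $k - 1$.
\<close>
lemma vwp_sum_telescopes:
  assumes nx: "\<And>j. of_nat j + 3/4 + x \<noteq> (0::rat)" and ny: "\<And>j. of_nat j + 3/4 + y \<noteq> (0::rat)"
    and t: "t \<le> 0"
  shows "(\<Sum>k<n. vwp_term t x y k *
      ((of_nat k + 1/2) * (of_nat k - 1/4) * ((of_nat k - 1/4)^2 - t) * (of_nat k - x) * (of_nat k - y)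
       - of_nat k * (of_nat k - 3/4) * ((of_nat k)^2 - t) * (of_nat k - 1/4 + x) * (of_nat k - 1/4 + y)))
    = vwp_term t x y n * (of_nat n * (of_nat n - 3/4) * ((of_nat n)^2 - t) * (of_nat n - 1/4 + x) * (of_nat n - 1/4 + y))"
proof (induction n)
  case 0
  show ?case by simp
next
  case (Suc n)
  define K where "K = (of_nat n :: rat)"
  have K: "K \<ge> 0" by (simp add: K_def)
  define N where "N = (K + 1/2) * (K - 1/4) * ((K - 1/4)^2 - t) * (K - x) * (K - y)"
  define L where "L = (K + 1/4) * (K + 1) * ((K + 1)^2 - t) * (K + 3/4 + x) * (K + 3/4 + y)"
  have "(K + 1)^2 > 0" using K by (intro zero_less_power) auto
  then have "L \<noteq> 0" using nx[of n] ny[of n] K t unfolding L_def K_def[symmetric] by auto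
  then have step: "vwp_term t x y (Suc n) * L = vwp_term t x y n * N"
    unfolding vwp_term_Suc K_def[symmetric] N_def[symmetric] L_def[symmetric] by simp
  have L': "of_nat (Suc n) * (of_nat (Suc n) - 3/4) * ((of_nat (Suc n))^2 - t) * (of_nat (Suc n) - 1/4 + x) * (of_nat (Suc n) - 1/4 + y) = L"
    unfolding L_def K_def by (simp add: algebra_simps)
  show ?case unfolding L' step sum.lessThan_Suc Suc
    unfolding K_def[symmetric] N_def[symmetric] by (simp add: algebra_simps)
qed

lemma odd_combination_ne_0: "(4 * of_nat j - 4 * of_nat m + 2 * of_nat i + 1 :: rat) \<noteq> 0"
proof
  assume "4 * of_nat j - 4 * of_nat m + 2 * of_nat i + 1 = (0::rat)"
  then have "of_int (4 * int j - 4 * int m + 2 * int i + 1) = (0::rat)" by simp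
  then have "4 * int j - 4 * int m + 2 * int i + 1 = 0" by (simp only: of_int_eq_0_iff)
  then show False by presburger
qed

definition half_quot :: "rat \<Rightarrow> nat \<Rightarrow> rat" where
  "half_quot t m = (\<Prod>j<m. ((of_nat j + 1/2)^2 - t) / ((of_nat j + 1)^2 - t))"

text \<open>
  At $x = m+1$, $y = 1/2 - m$ the telescoping expression is $8k - 1$ times a quadratic
  polynomial $e$ in $\lambda_k$, so the sum of $(8k-1)e$ times the terms vanishes. The coefficients of $e$ are
  read off from $k = 0$, from $k = -1/2$, where $\lambda = 3/8$, and from the leading coefficient.
  The numbers $\mu$ and $\nu$ are the constants of the contiguity relations that lead down to $m$ and
  to $m+1$. The identities express the weights $1$ and $\lambda - t$ on the terms for $m+1$ by
  weights linear in $\lambda$ on the terms for $m$, up to a multiple of $e$; the two coefficients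
  of the linear weight and the multiple are the solution of three linear equations.
\<close>
lemma vwp_moments_step:
  fixes M t la D mu nu e :: rat
  assumes "D = (M + 1)^2 - t" and "mu = (M + 1) * (M + 3/4)" and "nu = (M - 1/2) * (M - 1/4)"
    and "e = - (1/8) * (M - 1/2) * (M + 1) * (1/16 - t)
       + (8/3 * (- (1/8) * (1/4 - t) * (M + 1/4)^2 + (1/8) * (M - 1/2) * (M + 1) * (1/16 - t) + 9/256)) * la - la^2 / 4"
  shows "D * mu * (nu - la) =
      (mu - la) * (nu * D + (M - 1/2) * (1/16 - t) - 2 * (M + 3/4) * la) + 8 * (M + 3/4) * e"
    and "D * mu * (nu - la) * (la - t) =
      (mu - la) * (- nu * D * t + (mu - t) * (M - 1/2) * (1/16 - t) + (mu * D - 2 * (M + 3/4) * (mu - t)) * la)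
      + 8 * (M + 3/4) * (mu - t) * e"
  unfolding assms by (simp_all add: field_simps power2_eq_square)

text \<open>
  The closed forms satisfy the linear recurrence in $m$ that the polynomial identities
  above give for the two sums.
\<close>
lemma closed_form_step:
  fixes M t D mu nu :: rat
  assumes "D = (M + 1)^2 - t" and "mu = (M + 1) * (M + 3/4)" and "nu = (M - 1/2) * (M - 1/4)"
    and "C = (M - 1/2)^2 - t"
    and "a = (4 * M - 1) * (1/4 - M * (M - 1/2) - t)"
    and "b = (4 * M - 1) / 4 * (4 * t^2 - (1 + 4 * M * (M - 1/2)) * t + M * (M - 1/2) / 2)"
  shows "(nu * D + (M - 1/2) * (1/16 - t) - 2 * (M + 3/4) * t) * a - 2 * (M + 3/4) * b =
      nu * ((4 * M + 3) * (1/4 - (M + 1) * (M + 1/2) - t)) * C"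
    and "(- nu * D * t + (mu - t) * (M - 1/2) * (1/16 - t) + (mu * D - 2 * (M + 3/4) * (mu - t)) * t) * a
       + (mu * D - 2 * (M + 3/4) * (mu - t)) * b =
      nu * ((4 * M + 3) / 4 * (4 * t^2 - (1 + 4 * (M + 1) * (M + 1/2)) * t + (M + 1) * (M + 1/2) / 2)) * C"
  unfolding assms by (simp_all add: field_simps power2_eq_square)

text \<open>
  The sum with weight $1$ is not balanced, so Dougall's formula does not apply to it. If
  $t = s^2$, then the weights $\lambda_k - t \pm s/4 = (k - 1/4 \pm s)(k \mp s)$ turn the summands into
  those of two balanced series. So Dougall's formula evaluates both combinations, and these
  span the two sums below. In terms of $t$, the two sums satisfy a first-order linear system
  in $m$, which gives an induction that never mentions $s$.
\<close>
lemma vwp_moments: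
  assumes t: "t \<le> 0"
  shows "(\<Sum>k\<le>m. (8 * of_nat k - 1) * vwp_term t (of_nat m) (1/2 - of_nat m) k) =
      (4 * of_nat m - 1) * (1/4 - of_nat m * (of_nat m - 1/2) - t) * (half_quot t m / ((of_nat m - 1/2)^2 - t)) \<and>
    (\<Sum>k\<le>m. (8 * of_nat k - 1) * (of_nat k * (of_nat k - 1/4) - t) * vwp_term t (of_nat m) (1/2 - of_nat m) k) =
      (4 * of_nat m - 1) / 4 * (4 * t^2 - (1 + 4 * of_nat m * (of_nat m - 1/2)) * t + of_nat m * (of_nat m - 1/2) / 2)
        * (half_quot t m / ((of_nat m - 1/2)^2 - t))"
proof (induction m)
  case 0
  have "1/4 - t \<noteq> 0" using t by auto
  then show ?case by (simp add: vwp_term_def half_quot_def power2_eq_square field_simps)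
next
  case (Suc m)
  define M where "M = (of_nat m :: rat)"
  have M: "M \<ge> 0" by (simp add: M_def)
  have SM: "of_nat (Suc m) = M + 1" by (simp add: M_def)
  \<comment> \<open>The terms for $m$ and $m+1$ are both multiples of \<open>w k\<close>.\<close>
  define w where "w k = (8 * of_nat k - 1) * vwp_term t (M + 1) (1/2 - M) k" for k
  define la where "la k = (of_nat k * (of_nat k - 1/4) :: rat)" for k
  define mu where "mu = (M + 1) * (M + 3/4)"
  define nu where "nu = (M - 1/2) * (M - 1/4)"
  define D where "D = (M + 1)^2 - t"
  define C where "C = (M - 1/2)^2 - t"
  define H where "H = half_quot t m / C"
  define f where "f k = (8 * of_nat k - 1) * vwp_term t M (1/2 - M) k" for k
  define f' where "f' k = (8 * of_nat k - 1) * vwp_term t (M+1) (-1/2 - M) k" for k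
  have ne0: "of_nat j + 3/4 + M \<noteq> 0" "of_nat j + 3/4 + (M + 1) \<noteq> 0" for j
    using M of_nat_0_le_iff[of j, where ?'a=rat] by linarith+
  have ne1: "of_nat j + 3/4 + (1/2 - M) \<noteq> 0" for j
    using odd_combination_ne_0[of j m 2] by (simp add: M_def field_simps)
  have ne2: "of_nat j + 3/4 + (- 1/2 - M) \<noteq> 0" for j
    using odd_combination_ne_0[of j m 0] by (simp add: M_def field_simps)
  have mu0: "mu > 0" unfolding mu_def using M by (intro mult_pos_pos) auto
  \<comment> \<open>Since $4m$ is neither $1$ nor $2$, \<open>nu\<close> does not vanish.\<close>
  have nq: "M - 1/4 \<noteq> 0" using ne2[of 0] by (simp add: algebra_simps)
  have nh: "M - 1/2 \<noteq> 0"
  proof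
    assume "M - 1/2 = 0"
    then have "of_int (2 * int m) = (of_int 1 :: rat)" by (simp add: M_def)
    then have "2 * int m = 1" by (simp only: of_int_eq_iff)
    then show False by presburger
  qed
  have nu0: "nu \<noteq> 0" using nq nh by (simp add: nu_def)
  have "(M + 1)^2 > 0" using M by (intro zero_less_power) auto
  then have D0: "D > 0" unfolding D_def using t by linarith
  have "(M - 1/2)^2 > 0" using nh by simp
  then have C0: "C > 0" unfolding C_def using t by linarith
  have "(M + 1/2)^2 > 0" using M by (intro zero_less_power) auto
  then have C': "(M + 1/2)^2 - t > 0" using t by linarith
  have scale: "c * T = c * W * (1 - l / u)" if "T * u = W * (u - l)" "u \<noteq> 0" for c T u W l :: rat
  proof -
    have "T = W * (u - l) / u" using that by (simp add: eq_divide_eq)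
    also have "\<dots> = W * (1 - l / u)" using that(2) by (simp add: diff_divide_distrib right_diff_distrib)
    finally show ?thesis by simp
  qed
  have low: "f k = w k * (1 - la k / mu)" for k
    unfolding f_def w_def using vwp_term_contiguous[OF ne0(1), of t "1/2 - M" k] mu0
    unfolding mu_def[symmetric] by (intro scale) (simp_all add: la_def)
  have nu': "(-1/2 - M + 1) * (-1/2 - M + 3/4) = nu" "-1/2 - M + 1 = 1/2 - M"
    by (simp_all add: nu_def field_simps)
  have up: "f' k = w k * (1 - la k / nu)" for k
    unfolding f'_def w_def vwp_term_commute[of t "M+1"]
    using vwp_term_contiguous[OF ne2, of t "M+1" k, unfolded nu'(1), unfolded nu'(2), folded la_def] nu0
    by (rule scale)
  define e where "e k = - (1/8) * (M - 1/2) * (M + 1) * (1/16 - t)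
       + (8/3 * (- (1/8) * (1/4 - t) * (M + 1/4)^2 + (1/8) * (M - 1/2) * (M + 1) * (1/16 - t) + 9/256)) * la k - (la k)^2 / 4"
    for k
  have E: "(\<Sum>k\<le>Suc m. w k * e k) = 0"
  proof -
    have "(\<Sum>k\<le>Suc m. w k * e k) = (\<Sum>k<Suc (Suc m). vwp_term t (M + 1) (1/2 - M) k *
      ((of_nat k + 1/2) * (of_nat k - 1/4) * ((of_nat k - 1/4)^2 - t) * (of_nat k - (M + 1)) * (of_nat k - (1/2 - M))
       - of_nat k * (of_nat k - 3/4) * ((of_nat k)^2 - t) * (of_nat k - 1/4 + (M + 1)) * (of_nat k - 1/4 + (1/2 - M))))"
      unfolding lessThan_Suc_atMost w_def e_def la_def
      by (rule sum.cong) (simp_all add: field_simps power2_eq_square)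
    also have "\<dots> = 0"
      unfolding vwp_sum_telescopes[OF ne0(2) ne1 t] unfolding SM[symmetric] by (simp add: vwp_term_eq_0 del: of_nat_Suc)
    finally show ?thesis .
  qed
  \<comment> \<open>The sum over \<open>w\<close> runs one step further than the sums for $m$, where the terms vanish.\<close>
  define A where "A = (\<Sum>k\<le>m. f k)"
  define B where "B = (\<Sum>k\<le>m. (la k - t) * f k)"
  have "f (Suc m) = 0" unfolding f_def M_def using vwp_term_eq_0[of m "Suc m"] by simp
  then have A: "A = (\<Sum>k\<le>Suc m. f k)" and B: "B = (\<Sum>k\<le>Suc m. (la k - t) * f k)"
    by (simp_all add: A_def B_def)
  define A' where "A' = (\<Sum>k\<le>Suc m. f' k)"
  define B' where "B' = (\<Sum>k\<le>Suc m. (la k - t) * f' k)"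
  have recA: "mu * (nu * D * A') = mu * ((nu * D + (M - 1/2) * (1/16 - t) - 2 * (M + 3/4) * t) * A - 2 * (M + 3/4) * B)"
  proof -
    have "mu * nu * D * f' k = mu * (nu * D + (M - 1/2) * (1/16 - t) - 2 * (M + 3/4) * t) * f k
       - mu * 2 * (M + 3/4) * ((la k - t) * f k) + 8 * (M + 3/4) * (w k * e k)" for k
    proof -
      have "mu * nu * D * f' k = w k * (D * mu * (nu - la k))"
        unfolding up using nu0 by (simp add: field_simps)
      also have "\<dots> = w k * (mu - la k) * (nu * D + (M - 1/2) * (1/16 - t) - 2 * (M + 3/4) * la k) + 8 * (M + 3/4) * (w k * e k)"
        unfolding vwp_moments_step(1)[OF D_def mu_def nu_def e_def] by (simp add: distrib_left)
      also have "w k * (mu - la k) = mu * f k"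
        unfolding low using mu0 by (simp add: field_simps)
      finally show ?thesis by (simp add: field_simps)
    qed
    then have "mu * nu * D * A' = mu * (nu * D + (M - 1/2) * (1/16 - t) - 2 * (M + 3/4) * t) * A
       - mu * 2 * (M + 3/4) * B + 8 * (M + 3/4) * (\<Sum>k\<le>Suc m. w k * e k)"
      unfolding A A'_def B by (simp only: sum_distrib_left sum.distrib sum_subtractf)
    then show ?thesis unfolding E by (simp add: algebra_simps)
  qed
  have recB: "mu * (nu * D * B') = mu * ((- nu * D * t + (mu - t) * (M - 1/2) * (1/16 - t) + (mu * D - 2 * (M + 3/4) * (mu - t)) * t) * A
     + (mu * D - 2 * (M + 3/4) * (mu - t)) * B)"
  proof -
    have "mu * nu * D * ((la k - t) * f' k) = mu * (- nu * D * t + (mu - t) * (M - 1/2) * (1/16 - t) + (mu * D - 2 * (M + 3/4) * (mu - t)) * t) * f k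
       + mu * (mu * D - 2 * (M + 3/4) * (mu - t)) * ((la k - t) * f k) + 8 * (M + 3/4) * (mu - t) * (w k * e k)" for k
    proof -
      have "mu * nu * D * ((la k - t) * f' k) = w k * (D * mu * (nu - la k) * (la k - t))"
        unfolding up using nu0 by (simp add: field_simps)
      also have "\<dots> = w k * (mu - la k) * (- nu * D * t + (mu - t) * (M - 1/2) * (1/16 - t) + (mu * D - 2 * (M + 3/4) * (mu - t)) * la k)
          + 8 * (M + 3/4) * (mu - t) * (w k * e k)"
        unfolding vwp_moments_step(2)[OF D_def mu_def nu_def e_def] by (simp add: distrib_left)
      also have "w k * (mu - la k) = mu * f k"
        unfolding low using mu0 by (simp add: field_simps)
      finally show ?thesis by (simp add: field_simps)
    qed
    then have "mu * nu * D * B' = mu * (- nu * D * t + (mu - t) * (M - 1/2) * (1/16 - t) + (mu * D - 2 * (M + 3/4) * (mu - t)) * t) * A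
       + mu * (mu * D - 2 * (M + 3/4) * (mu - t)) * B + 8 * (M + 3/4) * (mu - t) * (\<Sum>k\<le>Suc m. w k * e k)"
      unfolding A B'_def B by (simp only: sum_distrib_left sum.distrib)
    then show ?thesis unfolding E by (simp add: algebra_simps)
  qed
  define a where "a = (4 * M - 1) * (1/4 - M * (M - 1/2) - t)"
  define b where "b = (4 * M - 1) / 4 * (4 * t^2 - (1 + 4 * M * (M - 1/2)) * t + M * (M - 1/2) / 2)"
  have IA: "A = a * H" and IB: "B = b * H"
    using Suc unfolding A_def B_def f_def la_def H_def C_def M_def a_def b_def by (auto simp: mult_ac)
  note cf = closed_form_step[OF D_def mu_def nu_def C_def a_def b_def]
  have cancel: "x = y * (H * C / D)" if "mu * (nu * D * x) = mu * (z * H)" "z = nu * y * C" for x y z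
  proof -
    have "nu * D * x = nu * (y * (H * C))" using that mu0 by (simp add: mult_ac)
    then show ?thesis using nu0 D0 by (simp add: field_simps)
  qed
  have cA: "A' = ((4 * M + 3) * (1/4 - (M + 1) * (M + 1/2) - t)) * (H * C / D)"
  proof (rule cancel[OF _ cf(1)])
    show "mu * (nu * D * A') = mu * (((nu * D + (M - 1/2) * (1/16 - t) - 2 * (M + 3/4) * t) * a - 2 * (M + 3/4) * b) * H)"
      using recA unfolding IA IB by (simp add: left_diff_distrib mult.assoc)
  qed
  have cB: "B' = ((4 * M + 3) / 4 * (4 * t^2 - (1 + 4 * (M + 1) * (M + 1/2)) * t + (M + 1) * (M + 1/2) / 2)) * (H * C / D)"
  proof (rule cancel[OF _ cf(2)])
    show "mu * (nu * D * B') = mu * (((- nu * D * t + (mu - t) * (M - 1/2) * (1/16 - t) + (mu * D - 2 * (M + 3/4) * (mu - t)) * t) * a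
       + (mu * D - 2 * (M + 3/4) * (mu - t)) * b) * H)"
      using recB unfolding IA IB by (simp add: distrib_right mult.assoc)
  qed
  have H': "half_quot t (Suc m) / ((M + 1/2)^2 - t) = H * C / D"
    using C' C0 unfolding half_quot_def H_def by (simp add: M_def D_def)
  have sh: "1/2 - of_nat (Suc m) = -1/2 - M" "of_nat (Suc m) - 1/2 = M + 1/2" "4 * of_nat (Suc m) - 1 = 4 * M + 3"
    by (simp_all add: M_def)
  show ?case unfolding sh H' unfolding SM using cA cB by (simp add: A'_def B'_def la_def f'_def mult_ac)
qed

text \<open>
  With $m = (q+1)/4$ and $t = -(q/4)^2$ the cofactor in the numerator collapses to the
  constant $5/16$.
\<close>
lemma vwp_sum_closed_form:
  assumes q: "q = 4 * of_nat m - (1::rat)"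
  shows "(\<Sum>k\<le>m. (8 * of_nat k - 1) * vwp_term (- (q^2 / 16)) (of_nat m) (1/2 - of_nat m) k) =
    q * (5 / ((q - 1)^2 + q^2) * half_quot (- (q^2 / 16)) m)"
proof -
  have m: "of_nat m = (q + 1) / 4" using q by simp
  have t: "- (q^2 / 16) \<le> 0" by simp
  have e1: "1/4 - of_nat m * (of_nat m - 1/2) - - (q^2 / 16) = 5/16"
    unfolding m by (simp add: field_simps power2_eq_square)
  have e2: "(of_nat m - 1/2)^2 - - (q^2 / 16) = ((q - 1)^2 + q^2) / 16"
    unfolding m by (simp add: field_simps power2_eq_square)
  show ?thesis
    using vwp_moments[OF t, of m, THEN conjunct1] unfolding q[symmetric] e1 e2 by simp
qed

section \<open>Factoring off the perturbed part of the summand\<close>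

definition outer_term :: "nat \<Rightarrow> rat" where
  "outer_term k = (\<Prod>j<k. (of_nat j + 1/2) * (of_nat j - 1/4) / ((of_nat j + 1/4) * (of_nat j + 1)))"

definition quartic_quot :: "rat \<Rightarrow> nat \<Rightarrow> rat" where
  "quartic_quot w k = (\<Prod>j<k. ((of_nat j - 1/4)^4 - w) / ((of_nat j + 1)^4 - w))"

lemma summand_eq:
  "pochhammer (1/2) k * pochhammer (- 1/4) k ^ 5 / (pochhammer (1/4) k * fact k ^ 5) =
    outer_term k * quartic_quot 0 k"
proof -
  have "fact k = pochhammer (1::rat) k" by (rule pochhammer_fact)
  then show ?thesis
    unfolding outer_term_def quartic_quot_def pochhammer_prod
    by (simp add: prod_power_distrib[symmetric] prod.distrib prod_dividef atLeast0LessThan eval_nat_numeral mult_ac add_ac)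
qed

text \<open>
  Here $(y - q/4)(y + q/4)(y^2 + (q/4)^2) = y^4 - (q/4)^4$ is used with $y = j - 1/4$ and $y = j + 1$.
\<close>
lemma vwp_term_eq:
  assumes q: "q = 4 * of_nat m - (1::rat)"
  shows "vwp_term (- (q^2 / 16)) (of_nat m) (1/2 - of_nat m) k = outer_term k * quartic_quot (q^4 / 256) k"
proof -
  have m: "of_nat m = (q + 1) / 4" using q by simp
  have e: "((x - 1/4)^2 - - (q^2 / 16)) * (x - (q + 1) / 4) * (x - (1/2 - (q + 1) / 4)) = (x - 1/4)^4 - q^4 / 256"
    "((x + 1)^2 - - (q^2 / 16)) * (x + 3/4 + (q + 1) / 4) * (x + 3/4 + (1/2 - (q + 1) / 4)) = (x + 1)^4 - q^4 / 256"
    for x :: rat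
    by (simp_all add: field_simps eval_nat_numeral)
  show ?thesis
    unfolding vwp_term_def outer_term_def quartic_quot_def prod.distrib[symmetric] m e[symmetric]
    by (intro prod.cong) (simp_all add: mult_ac)
qed

section \<open>Rational numbers that are integral at a prime\<close>

definition p_integral :: "nat \<Rightarrow> rat set" where
  "p_integral p = {x. \<exists>a b. \<not> int p dvd b \<and> x = of_int a / of_int b}"

lemma p_integral_of_int [simp]: "prime p \<Longrightarrow> of_int a \<in> p_integral p"
  unfolding p_integral_def using prime_gt_1_nat[of p] by (intro CollectI exI[of _ a] exI[of _ 1]) simp

lemma p_integral_of_nat [simp]: "prime p \<Longrightarrow> of_nat a \<in> p_integral p"
  using p_integral_of_int[of p "int a"] by simp

lemma p_integral_numeral [simp]:
  "prime p \<Longrightarrow> numeral a \<in> p_integral p" "prime p \<Longrightarrow> 1 \<in> p_integral p" "prime p \<Longrightarrow> 0 \<in> p_integral p"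
  using p_integral_of_int[of p "numeral a"] p_integral_of_int[of p 1] p_integral_of_int[of p 0] by simp_all

lemma p_integral_mult:
  assumes "prime p" "x \<in> p_integral p" "y \<in> p_integral p" shows "x * y \<in> p_integral p"
proof -
  from assms obtain a b c d where *: "\<not> int p dvd b" "x = of_int a / of_int b" "\<not> int p dvd d" "y = of_int c / of_int d"
    unfolding p_integral_def by auto
  then have "x * y = of_int (a * c) / of_int (b * d)" by simp
  moreover have "\<not> int p dvd b * d" using * assms(1) by (simp add: prime_dvd_mult_iff)
  ultimately show ?thesis unfolding p_integral_def by blast
qed

lemma p_integral_add:
  assumes "prime p" "x \<in> p_integral p" "y \<in> p_integral p" shows "x + y \<in> p_integral p"
proof -
  from assms obtain a b c d where *: "\<not> int p dvd b" "x = of_int a / of_int b" "\<not> int p dvd d" "y = of_int c / of_int d"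
    unfolding p_integral_def by auto
  then have "b \<noteq> 0" "d \<noteq> 0" by auto
  then have "x + y = of_int (a * d + c * b) / of_int (b * d)" using * by (simp add: field_simps)
  moreover have "\<not> int p dvd b * d" using * assms(1) by (simp add: prime_dvd_mult_iff)
  ultimately show ?thesis unfolding p_integral_def by blast
qed

lemma p_integral_uminus: "prime p \<Longrightarrow> x \<in> p_integral p \<Longrightarrow> - x \<in> p_integral p"
  using p_integral_mult[of p "of_int (-1)" x, OF _ p_integral_of_int] by simp

lemma p_integral_diff: "prime p \<Longrightarrow> x \<in> p_integral p \<Longrightarrow> y \<in> p_integral p \<Longrightarrow> x - y \<in> p_integral p"
  using p_integral_add[of p x "- y"] by (simp add: p_integral_uminus)

lemma p_integral_power: "prime p \<Longrightarrow> x \<in> p_integral p \<Longrightarrow> x ^ n \<in> p_integral p"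
  by (induction n) (simp_all add: p_integral_mult)

lemma p_integral_sum: "prime p \<Longrightarrow> (\<And>i. i \<in> A \<Longrightarrow> f i \<in> p_integral p) \<Longrightarrow> sum f A \<in> p_integral p"
  by (induction A rule: infinite_finite_induct) (simp_all add: p_integral_add)

lemma p_integral_prod: "prime p \<Longrightarrow> (\<And>i. i \<in> A \<Longrightarrow> f i \<in> p_integral p) \<Longrightarrow> prod f A \<in> p_integral p"
  by (induction A rule: infinite_finite_induct) (simp_all add: p_integral_mult)

lemma p_integral_divide:
  assumes "prime p" "x \<in> p_integral p" "\<not> int p dvd n"
  shows "x / of_int n \<in> p_integral p"
proof -
  have "of_int 1 / of_int n \<in> p_integral p" unfolding p_integral_def using assms(3) by blast
  from p_integral_mult[OF assms(1,2) this] show ?thesis by simp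
qed

text \<open>
  A congruence between arbitrary rationals, which need not be integral at $p$ themselves.
  This matters because single terms of the sum can have a $p$ in the denominator.
\<close>
definition rcong :: "nat \<Rightarrow> nat \<Rightarrow> rat \<Rightarrow> rat \<Rightarrow> bool" where
  "rcong p n x y \<longleftrightarrow> (\<exists>z \<in> p_integral p. x - y = of_nat p ^ n * z)"

lemma rat_cong_if_rcong:
  assumes p: "prime p" and "rcong p n A B"
  shows "rat_cong A B (int p ^ n)"
proof -
  from assms obtain a b where b: "\<not> int p dvd b" and ab: "A - B = of_nat p ^ n * (of_int a / of_int b)"
    unfolding rcong_def p_integral_def by blast
  obtain c d where q: "quotient_of (A - B) = (c, d)" by fastforce
  then have d: "d > 0" and eq: "A - B = of_int c / of_int d"
    using quotient_of_denom_pos quotient_of_div by auto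
  have "b \<noteq> 0" using b by auto
  then have "of_int (c * b) = (of_int (int p ^ n * a * d) :: rat)"
    using eq ab d by (simp add: field_simps)
  then have "c * b = int p ^ n * a * d" by (simp only: of_int_eq_iff)
  then have "int p ^ n dvd c * b" by simp
  moreover have "coprime (int p ^ n) b"
    using p b by (intro coprime_power_left_iff[THEN iffD2] disjI1 prime_imp_coprime) auto
  ultimately show ?thesis unfolding rat_cong_def q by (simp add: coprime_dvd_mult_left_iff)
qed

lemma rcong_refl [simp]: "prime p \<Longrightarrow> rcong p n x x"
  unfolding rcong_def by (rule bexI[of _ 0]) simp_all

lemma rcong_mult:
  assumes p: "prime p" and "rcong p n a b" "rcong p n c d" and i: "b \<in> p_integral p" "c \<in> p_integral p"
  shows "rcong p n (a * c) (b * d)"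
proof -
  from assms obtain x y where x: "x \<in> p_integral p" "a - b = of_nat p ^ n * x" and y: "y \<in> p_integral p" "c - d = of_nat p ^ n * y"
    unfolding rcong_def by auto
  have "a * c - b * d = (a - b) * c + b * (c - d)" by (simp add: algebra_simps)
  also have "\<dots> = of_nat p ^ n * (x * c + b * y)" unfolding x y by (simp add: algebra_simps)
  finally show ?thesis unfolding rcong_def by (rule bexI[of _ "x * c + b * y"]) (simp_all add: p x y i p_integral_add p_integral_mult)
qed

lemma rcong_prod:
  assumes p: "prime p" and "\<And>i. i \<in> A \<Longrightarrow> rcong p n (f i) (g i)"
    and "\<And>i. i \<in> A \<Longrightarrow> f i \<in> p_integral p" "\<And>i. i \<in> A \<Longrightarrow> g i \<in> p_integral p"
  shows "rcong p n (prod f A) (prod g A)"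
  using assms(2-)
proof (induction A rule: infinite_finite_induct)
  case (insert x A)
  have "rcong p n (f x * prod f A) (g x * prod g A)"
    by (rule rcong_mult[OF p]) (use insert p in \<open>blast intro: p_integral_prod\<close>)+
  then show ?case using insert by simp
qed (simp_all add: p rcong_refl)

lemma rcong_sum:
  assumes p: "prime p" and "\<And>i. i \<in> A \<Longrightarrow> rcong p n (f i) (g i)"
  shows "rcong p n (sum f A) (sum g A)"
proof -
  from assms(2) obtain z where z: "\<And>i. i \<in> A \<Longrightarrow> z i \<in> p_integral p \<and> f i - g i = of_nat p ^ n * z i"
    unfolding rcong_def by metis
  then have "sum f A - sum g A = of_nat p ^ n * sum z A"
    by (simp add: sum_subtractf[symmetric] sum_distrib_left)
  then show ?thesis unfolding rcong_def using p_integral_sum[OF p, of A z] z by blast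
qed

lemma rcong_trans:
  assumes p: "prime p" and "rcong p n a b" "rcong p n b c"
  shows "rcong p n a c"
proof -
  from assms obtain x y where x: "x \<in> p_integral p" "a - b = of_nat p ^ n * x" and y: "y \<in> p_integral p" "b - c = of_nat p ^ n * y"
    unfolding rcong_def by auto
  have "a - c = (a - b) + (b - c)" by simp
  also have "\<dots> = of_nat p ^ n * (x + y)" unfolding x y by (simp add: algebra_simps)
  finally show ?thesis unfolding rcong_def by (rule bexI[of _ "x + y"]) (simp_all add: p x y p_integral_add)
qed

lemma p_integral_imp_rcong_0: "x = of_nat p ^ n * z \<Longrightarrow> z \<in> p_integral p \<Longrightarrow> rcong p n x 0"
  unfolding rcong_def by auto

lemma rcong_sym: "prime p \<Longrightarrow> rcong p n a b \<Longrightarrow> rcong p n b a"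
  unfolding rcong_def by (metis minus_diff_eq mult_minus_right p_integral_uminus)

lemma rcong_divide:
  assumes p: "prime p" and "rcong p n a b" "rcong p n c d"
    and i: "b \<in> p_integral p" "1 / c \<in> p_integral p" "1 / d \<in> p_integral p" and nz: "c \<noteq> 0" "d \<noteq> 0"
  shows "rcong p n (a / c) (b / d)"
proof -
  from assms obtain x y where x: "x \<in> p_integral p" "a - b = of_nat p ^ n * x" and y: "y \<in> p_integral p" "c - d = of_nat p ^ n * y"
    unfolding rcong_def by auto
  have "a / c - b / d = (a - b) * (1 / c) - b * (c - d) * (1 / c) * (1 / d)" using nz by (simp add: field_simps)
  also have "\<dots> = of_nat p ^ n * (x * (1 / c) - b * y * (1 / c) * (1 / d))" unfolding x y by (simp add: algebra_simps)
  finally show ?thesis unfolding rcong_def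
    by (rule bexI) (intro p_integral_diff p_integral_mult p i x(1) y(1))
qed

text \<open>
  For $j < p$, at most one of the numbers $4j + 1$ is divisible by $p$, and as $4j+1 \le 4p - 3 < p^2$,
  it is not divisible by $p^2$.
\<close>
lemma p_integral_inverse_pochhammer_quarter:
  assumes p: "prime p" "p > 3" and k: "k \<le> p"
  shows "of_nat p * (\<Prod>j<k. 1 / (of_nat j + 1/4)) \<in> p_integral p"
proof -
  have f: "1 / (of_nat j + 1/4) = 4 / (of_int (4 * int j + 1) :: rat)" for j :: nat
    by (simp add: field_simps)
  show ?thesis
  proof (cases "\<exists>i<k. int p dvd 4 * int i + 1")
    case False
    then show ?thesis unfolding f
      by (intro p_integral_mult p_integral_prod p_integral_divide) (use p in auto)
  next
    case True
    then obtain i where i: "i < k" "int p dvd 4 * int i + 1" by auto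
    then obtain c where c: "4 * int i + 1 = int p * c" by auto
    have "c > 0" using c p by (metis of_nat_0_le_iff add.commute add_pos_nonneg mult_nonneg_nonneg zero_le_numeral zero_less_mult_pos zero_less_one of_nat_0_less_iff prime_gt_0_nat)
    have "int p * c < int p * int p"
    proof -
      have "int p * c \<le> 4 * int p - 3" using i k c by linarith
      also have "\<dots> < 4 * int p" by simp
      also have "\<dots> \<le> int p * int p" using p(2) by (intro mult_right_mono) auto
      finally show ?thesis .
    qed
    then have "c < int p" using p(2) by simp
    then have nc: "\<not> int p dvd c" using \<open>c > 0\<close> by (meson zdvd_not_zless)
    have others: "\<not> int p dvd 4 * int j + 1" if j: "j < k" "j \<noteq> i" for j
    proof
      assume "int p dvd 4 * int j + 1"
      then have "int p dvd (4 * int j + 1) - (4 * int i + 1)" using i(2) by (rule dvd_diff)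
      then have "int p dvd 4 * (int j - int i)" by (simp add: algebra_simps)
      moreover have "coprime (int p) 4"
      proof -
        have "\<not> int p dvd 2" using p(2) zdvd_not_zless[of 2 "int p"] by auto
        then have "coprime (int p) (2 ^ 2)" using p(1) by (intro coprime_power_right_iff[THEN iffD2] disjI1 prime_imp_coprime) auto
        then show ?thesis by simp
      qed
      ultimately have "int p dvd int j - int i" using coprime_dvd_mult_right_iff by blast
      then have "int p dvd \<bar>int j - int i\<bar>" by simp
      moreover have "\<bar>int j - int i\<bar> < int p" "\<bar>int j - int i\<bar> > 0" using j i k by auto
      ultimately show False using zdvd_not_zless by blast
    qed
    have "of_nat p * (\<Prod>j<k. 1 / (of_nat j + 1/4)) =
        of_nat p * (4 / (of_int (int p * c))) * (\<Prod>j\<in>{..<k} - {i}. 4 / (of_int (4 * int j + 1) :: rat))"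
      unfolding f using i(1) by (simp only: c[symmetric] prod.remove[of "{..<k}" i] finite_lessThan lessThan_iff mult.assoc)
    also have "of_nat p * (4 / (of_int (int p * c))) = 4 / (of_int c :: rat)"
      using p(2) by simp
    finally show ?thesis
      by (simp only:) (intro p_integral_mult p_integral_prod p_integral_divide, use p nc others in auto)
  qed
qed
section \<open>The perturbation modulo powers of a prime\<close>

lemma p_integral_half: "prime p \<Longrightarrow> p > 3 \<Longrightarrow> x \<in> p_integral p \<Longrightarrow> x / 2 \<in> p_integral p"
  using p_integral_divide[of p x 2] zdvd_not_zless[of 2 "int p"] by simp

lemma p_integral_inverse_nat:
  assumes "prime p" "0 < n" "n < p" shows "1 / of_nat n \<in> p_integral p"
  using p_integral_divide[of p 1 "int n"] zdvd_not_zless[of "int n" "int p"] assms by simp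

lemma p_integral_div_power2:
  assumes "prime p" "p > 3" "x \<in> p_integral p" shows "x / 2 ^ n \<in> p_integral p"
proof (induction n)
  case (Suc n)
  show ?case using p_integral_half[OF assms(1,2) Suc] by (simp add: mult.commute)
qed (use assms in simp)

lemma p_outer_term_integral:
  assumes p: "prime p" "p > 3" and k: "k < p"
  shows "of_nat p * outer_term k \<in> p_integral p"
proof -
  have "of_nat p * outer_term k =
      (\<Prod>j<k. (of_nat j + 1/2) * (of_nat j - 1/4) * (1 / of_nat (Suc j))) * (of_nat p * (\<Prod>j<k. 1 / (of_nat j + 1/4)))"
    unfolding outer_term_def mult.left_commute[of _ "of_nat p"] prod.distrib[symmetric]
    by (intro arg_cong2[of _ _ _ _ "(*)"] prod.cong) (simp_all add: mult_ac add_ac)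
  moreover have "(of_nat j + 1/2) * (of_nat j - 1/4) * (1 / of_nat (Suc j)) \<in> p_integral p" if "j < k" for j
    using that k p p_integral_half[OF p p_integral_numeral(2)] p_integral_div_power2[OF p p_integral_numeral(2), of 2]
    by (intro p_integral_mult p_integral_add p_integral_diff p_integral_of_nat p_integral_inverse_nat) auto
  ultimately show ?thesis
    using p_integral_inverse_pochhammer_quarter[OF p less_imp_le[OF k]]
    by (metis (no_types, lifting) lessThan_iff p(1) p_integral_mult p_integral_prod)
qed

text \<open>
  The perturbations of the denominators are $\pm q^r / 2^e$ with $r = 4, e = 8$ or
  $r = 2, e = 4$. They are divisible by $p$, so a denominator prime to $p$ remains so.
\<close>
lemma p_integral_inverse_perturbed:
  assumes p: "prime p" "p > 3" and n: "0 < n" "n < p" and q: "p dvd q" and r: "r > 0"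
  shows "1 / (of_nat n ^ r + of_int s * (of_nat q ^ r / 2 ^ e)) \<in> p_integral p"
    and "of_nat n ^ r + of_int s * (of_nat q ^ r / 2 ^ e) \<noteq> (0::rat)"
proof -
  define a where "a = 2 ^ e * int n ^ r + s * int q ^ r"
  have "\<not> int p dvd 2" using zdvd_not_zless[of 2 "int p"] p by simp
  moreover have "\<not> int p dvd int n" using zdvd_not_zless[of "int n" "int p"] n by simp
  ultimately have "\<not> int p dvd 2 ^ e * int n ^ r"
    using p prime_dvd_power[of "int p" 2 e] prime_dvd_power[of "int p" "int n" r] by (auto simp: prime_dvd_mult_iff)
  moreover have "int p dvd s * int q ^ r"
    using q r by (metis dvd_mult dvd_power dvd_trans int_dvd_int_iff of_nat_power)
  ultimately have a: "\<not> int p dvd a" unfolding a_def by (simp add: dvd_add_left_iff)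
  then have "a \<noteq> 0" by auto
  have eq: "of_nat n ^ r + of_int s * (of_nat q ^ r / 2 ^ e) = of_int a / (2 ^ e :: rat)"
    unfolding a_def by (simp add: field_simps)
  have "(2 ^ e :: rat) / of_int a \<in> p_integral p"
    using p a by (intro p_integral_divide p_integral_power p_integral_numeral) auto
  then show "1 / (of_nat n ^ r + of_int s * (of_nat q ^ r / 2 ^ e)) \<in> p_integral p" unfolding eq by simp
  show "of_nat n ^ r + of_int s * (of_nat q ^ r / 2 ^ e) \<noteq> (0::rat)" unfolding eq using \<open>a \<noteq> 0\<close> by simp
qed

lemma rcong_shift:
  assumes p: "prime p" "p > 3" and q: "p dvd q"
  shows "rcong p r (x + of_int s * (of_nat q ^ r / 2 ^ e)) x"
proof -
  obtain c where c: "q = p * c" using q by auto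
  have "of_int s * (of_nat c ^ r / 2 ^ e) \<in> p_integral p"
    using p by (intro p_integral_mult p_integral_of_int p_integral_div_power2 p_integral_power p_integral_of_nat)
  then show ?thesis unfolding rcong_def
    by (rule bexI[rotated]) (simp add: c power_mult_distrib)
qed

lemma rcong_perturbed_quot:
  assumes p: "prime p" "p > 3" and n: "0 < n" "n < p" and q: "p dvd q" and r: "r > 0" and x: "x \<in> p_integral p"
    and w_def: "w = of_int s * (of_nat q ^ r / 2 ^ e)"
  shows "rcong p r ((x + w) / (of_nat n ^ r + w)) (x / of_nat n ^ r)"
    and "(x + w) / (of_nat n ^ r + w) \<in> p_integral p" and "x / of_nat n ^ r \<in> p_integral p"
proof -
  note i = p_integral_inverse_perturbed[OF p n q r]
  have w: "w \<in> p_integral p" unfolding w_def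
    using p by (intro p_integral_mult p_integral_of_int p_integral_div_power2 p_integral_power p_integral_of_nat)
  have i0: "1 / of_nat n ^ r \<in> p_integral p" using i(1)[of 0 0] by simp
  show "rcong p r ((x + w) / (of_nat n ^ r + w)) (x / of_nat n ^ r)"
    unfolding w_def by (intro rcong_divide rcong_shift p q i x i0) (use n in simp)
  show "(x + w) / (of_nat n ^ r + w) \<in> p_integral p"
    using p_integral_mult[OF p(1) p_integral_add[OF p(1) x w] i(1)[of s e]] unfolding w_def by simp
  show "x / of_nat n ^ r \<in> p_integral p"
    using p_integral_mult[OF p(1) x i0] by simp
qed

lemma rcong_quartic_quot:
  assumes p: "prime p" "p > 3" and k: "k < p" and q: "p dvd q"
  shows "rcong p 4 (quartic_quot 0 k) (quartic_quot (of_nat q ^ 4 / 256) k)"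
proof -
  have "rcong p 4 (quartic_quot (of_nat q ^ 4 / 256) k) (quartic_quot 0 k)"
    unfolding quartic_quot_def
  proof (rule rcong_prod[OF p(1)])
    fix j assume j: "j \<in> {..<k}"
    have x: "(of_nat j - 1/4)^4 \<in> p_integral p"
      using p p_integral_div_power2[OF p p_integral_numeral(2), of 2]
      by (intro p_integral_power p_integral_diff p_integral_of_nat) auto
    have "0 < Suc j" "Suc j < p" using j k by auto
    note * = rcong_perturbed_quot[where r=4 and s="-1" and e=8, OF p this q _ x refl, simplified]
    show "rcong p 4 (((of_nat j - 1/4)^4 - of_nat q ^ 4 / 256) / ((of_nat j + 1)^4 - of_nat q ^ 4 / 256))
       (((of_nat j - 1/4)^4 - 0) / ((of_nat j + 1)^4 - 0))" using *(1) by (simp add: add_ac)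
    show "((of_nat j - 1/4)^4 - of_nat q ^ 4 / 256) / ((of_nat j + 1)^4 - of_nat q ^ 4 / 256) \<in> p_integral p"
      using *(2) by (simp add: add_ac)
    show "((of_nat j - 1/4)^4 - 0) / ((of_nat j + 1)^4 - 0) \<in> p_integral p"
      using *(3) by (simp add: add_ac)
  qed
  then show ?thesis by (rule rcong_sym[OF p(1)])
qed

lemma rcong_half_quot:
  assumes p: "prime p" "p > 3" and k: "m < p" and q: "p dvd q"
  shows "rcong p 2 (half_quot (- (of_nat q ^ 2 / 16)) m) (half_quot 0 m)"
    and "half_quot 0 m \<in> p_integral p"
    and "j < m \<Longrightarrow> ((of_nat j + 1/2)^2 + of_nat q ^ 2 / 16) / ((of_nat j + 1)^2 + of_nat q ^ 2 / 16) \<in> p_integral p"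
proof -
  have *: "rcong p 2 (((of_nat j + 1/2)^2 + of_nat q ^ 2 / 16) / ((of_nat j + 1)^2 + of_nat q ^ 2 / 16))
       ((of_nat j + 1/2)^2 / (of_nat j + 1)^2)"
     "((of_nat j + 1/2)^2 + of_nat q ^ 2 / 16) / ((of_nat j + 1)^2 + of_nat q ^ 2 / 16) \<in> p_integral p"
     "(of_nat j + 1/2)^2 / (of_nat j + 1)^2 \<in> p_integral p" if j: "j < m" for j
  proof -
    have x: "(of_nat j + 1/2)^2 \<in> p_integral p"
      using p p_integral_div_power2[OF p p_integral_numeral(2), of 1]
      by (intro p_integral_power p_integral_add p_integral_of_nat) auto
    have "0 < Suc j" "Suc j < p" using j k by auto
    note * = rcong_perturbed_quot[where r=2 and s=1 and e=4, OF p this q _ x refl, simplified]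
    show "rcong p 2 (((of_nat j + 1/2)^2 + of_nat q ^ 2 / 16) / ((of_nat j + 1)^2 + of_nat q ^ 2 / 16))
       ((of_nat j + 1/2)^2 / (of_nat j + 1)^2)" using *(1) by (simp add: add_ac)
    show "((of_nat j + 1/2)^2 + of_nat q ^ 2 / 16) / ((of_nat j + 1)^2 + of_nat q ^ 2 / 16) \<in> p_integral p"
      using *(2) by (simp add: add_ac)
    show "(of_nat j + 1/2)^2 / (of_nat j + 1)^2 \<in> p_integral p"
      using *(3) by (simp add: add_ac)
  qed
  show "rcong p 2 (half_quot (- (of_nat q ^ 2 / 16)) m) (half_quot 0 m)"
    unfolding half_quot_def diff_minus_eq_add diff_0_right by (intro rcong_prod p(1) *) auto
  show "half_quot 0 m \<in> p_integral p"
    unfolding half_quot_def diff_0_right by (intro p_integral_prod p(1) *) auto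
  show "j < m \<Longrightarrow> ((of_nat j + 1/2)^2 + of_nat q ^ 2 / 16) / ((of_nat j + 1)^2 + of_nat q ^ 2 / 16) \<in> p_integral p"
    by (rule *(2))
qed

section \<open>The congruence\<close>

text \<open>
  One of the four powers of $p$ gained by the perturbation is spent on the possible $p$ in the
  denominator of \<open>outer_term k\<close>. The perturbed terms with $m < k < p$ vanish, so
  extending the terminating sum to all $k < p$ is free.
\<close>
lemma sum_rcong_closed_form:
  assumes p: "prime p" "p > 3" and m: "4 * m = q + 1" "m < p" and q: "p dvd q"
  shows "rcong p 3 (\<Sum>k = 0..p - 1. (8 * of_nat k - 1) *
       (pochhammer (1/2) k * pochhammer (- 1/4) k ^ 5) / (pochhammer (1/4) k * fact k ^ 5))
     (of_nat q * (5 / ((of_nat q - 1)^2 + of_nat q ^ 2) * half_quot (- (of_nat q ^ 2 / 16)) m))"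
proof -
  have "4 * of_nat m = (of_nat q + 1 :: rat)" using m(1) by (metis of_nat_Suc of_nat_mult of_nat_numeral Suc_eq_plus1 add.commute)
  then have q': "of_nat q = 4 * of_nat m - (1::rat)" by simp
  have "(of_nat q * (5 / ((of_nat q - 1)^2 + of_nat q ^ 2) * half_quot (- (of_nat q ^ 2 / 16)) m)) =
    (\<Sum>k\<le>m. (8 * of_nat k - 1) * vwp_term (- (of_nat q ^ 2 / 16)) (of_nat m) (1/2 - of_nat m) k)"
    by (rule vwp_sum_closed_form[OF q', symmetric])
  also have "\<dots> = (\<Sum>k = 0..p - 1. (8 * of_nat k - 1) * vwp_term (- (of_nat q ^ 2 / 16)) (of_nat m) (1/2 - of_nat m) k)"
    using m(2) by (intro sum.mono_neutral_left) (auto simp: vwp_term_eq_0)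
  also have "\<dots> = (\<Sum>k = 0..p - 1. (8 * of_nat k - 1) * (outer_term k * quartic_quot (of_nat q ^ 4 / 256) k))"
    unfolding vwp_term_eq[OF q'] by simp
  finally have R: "of_nat q * (5 / ((of_nat q - 1)^2 + of_nat q ^ 2) * half_quot (- (of_nat q ^ 2 / 16)) m) = \<dots>" .
  have L: "(\<Sum>k = 0..p - 1. (8 * of_nat k - 1) *
       (pochhammer (1/2) k * pochhammer (- 1/4) k ^ 5) / (pochhammer (1/4) k * fact k ^ 5)) =
     (\<Sum>k = 0..p - 1. (8 * of_nat k - 1) * (outer_term k * quartic_quot 0 k))"
    unfolding summand_eq[symmetric] by simp
  show ?thesis unfolding L R
  proof (rule rcong_sum[OF p(1)])
    fix k assume "k \<in> {0..p - 1}"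
    then have k: "k < p" using p(2) by auto
    obtain z where z: "z \<in> p_integral p" "quartic_quot 0 k - quartic_quot (of_nat q ^ 4 / 256) k = of_nat p ^ 4 * z"
      using rcong_quartic_quot[OF p k q] unfolding rcong_def by auto
    have "(8 * of_nat k - 1) * (outer_term k * quartic_quot 0 k) - (8 * of_nat k - 1) * (outer_term k * quartic_quot (of_nat q ^ 4 / 256) k)
      = (8 * of_nat k - 1) * outer_term k * (quartic_quot 0 k - quartic_quot (of_nat q ^ 4 / 256) k)"
      by (simp add: algebra_simps)
    also have "\<dots> = of_nat p ^ 3 * ((8 * of_nat k - 1) * (of_nat p * outer_term k) * z)"
      unfolding z by (simp add: eval_nat_numeral mult_ac)
    finally show "rcong p 3 ((8 * of_nat k - 1) * (outer_term k * quartic_quot 0 k))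
        ((8 * of_nat k - 1) * (outer_term k * quartic_quot (of_nat q ^ 4 / 256) k))"
      unfolding rcong_def
      by (rule bexI) (intro p_integral_mult p_integral_diff p_outer_term_integral p_integral_of_nat p_integral_numeral p k z(1))
  qed
qed

lemma p_integral_inverse_sum_squares:
  assumes p: "prime p" and q: "p dvd q"
  shows "1 / ((of_nat q - 1)^2 + of_nat q ^ 2) \<in> p_integral p"
proof -
  obtain c where c: "q = p * c" using q by auto
  have "(int q - 1)^2 + int q ^ 2 = 1 + int p * (2 * int c * int q - 2 * int c)"
    unfolding c by (simp add: power2_eq_square algebra_simps)
  moreover have "\<not> int p dvd 1 + int p * (2 * int c * int q - 2 * int c)"
    using prime_gt_1_nat[OF p] by (simp add: dvd_add_left_iff)
  ultimately have "\<not> int p dvd (int q - 1)^2 + int q ^ 2" by simp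
  from p_integral_divide[OF p p_integral_numeral(2)[OF p] this] show ?thesis by simp
qed

theorem corollary1p4:
  fixes p :: nat and S :: rat
  assumes "prime p" and "odd p" and "p > 3"
  defines "S \<equiv> \<Sum>k = 0..p - 1. (8 * of_nat k - 1) *
       (pochhammer (1/2) k * pochhammer (- 1/4) k ^ 5) /
       (pochhammer (1/4) k * fact k ^ 5)"
  shows "(p mod 4 = 1 \<longrightarrow> rat_cong S 0 (int p ^ 3)) \<and>
    (p mod 4 = 3 \<longrightarrow> rat_cong S
       (5 * of_nat p * (of_nat p - 3) * pochhammer (1/2) ((p + 1) div 4) ^ 2 /
          ((7 * of_nat p - 3) * fact ((p + 1) div 4) ^ 2))
       (int p ^ 3))"
proof (intro conjI impI rat_cong_if_rcong[OF assms(1)])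
  note p = assms(1,3)
  assume "p mod 4 = 1"
  then have m: "4 * ((3 * p + 1) div 4) = 3 * p + 1" by presburger
  define m where "m = (3 * p + 1) div 4"
  \<comment> \<open>The factor of \<open>half_quot\<close> at this index is the one divisible by $p^2$.\<close>
  define i where "i = (p - 1) div 2"
  have i: "2 * i + 1 = p" using assms(2) unfolding i_def by presburger
  have m1: "4 * m = 3 * p + 1" using m by (simp add: m_def)
  have mp: "m < p" using m1 p(2) by linarith
  have im: "i < m" using i m1 by linarith
  define g where "g j = ((of_nat j + 1/2)^2 + of_nat (3 * p) ^ 2 / 16) / ((of_nat j + 1)^2 + of_nat (3 * p) ^ 2 / 16 :: rat)" for j
  have g: "g j \<in> p_integral p" if "j < m" for j
    unfolding g_def using rcong_half_quot(3)[OF p mp, of "3 * p" j] that by simp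
  have "of_nat p = (2 * of_nat i + 1 :: rat)" unfolding i[symmetric] by simp
  then have i2: "of_nat i + 1/2 = (of_nat p / 2 :: rat)" by simp
  have "g i = of_nat p ^ 2 * (13 / 2 ^ 4 * (1 / (of_nat (Suc i) ^ 2 + of_int 1 * (of_nat (3 * p) ^ 2 / 2 ^ 4))))"
    unfolding g_def i2 by (simp add: field_simps power2_eq_square)
  moreover have "13 / 2 ^ 4 * (1 / (of_nat (Suc i) ^ 2 + of_int 1 * (of_nat (3 * p) ^ 2 / 2 ^ 4))) \<in> p_integral p"
    using im mp by (intro p_integral_mult p_integral_div_power2 p_integral_inverse_perturbed p p_integral_numeral) auto
  ultimately obtain z where z: "g i = of_nat p ^ 2 * z" "z \<in> p_integral p" by blast
  have h: "half_quot (- (of_nat (3 * p) ^ 2 / 16)) m = of_nat p ^ 2 * (z * prod g ({..<m} - {i}))"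
  proof -
    have "half_quot (- (of_nat (3 * p) ^ 2 / 16)) m = prod g {..<m}"
      unfolding half_quot_def diff_minus_eq_add g_def ..
    also have "\<dots> = g i * prod g ({..<m} - {i})" using im by (intro prod.remove) auto
    finally show ?thesis unfolding z by (simp only: mult.assoc)
  qed
  have "rcong p 3 (of_nat (3 * p) * (5 / ((of_nat (3 * p) - 1)^2 + of_nat (3 * p) ^ 2) * half_quot (- (of_nat (3 * p) ^ 2 / 16)) m)) 0"
  proof (rule p_integral_imp_rcong_0)
    show "of_nat (3 * p) * (5 / ((of_nat (3 * p) - 1)^2 + of_nat (3 * p) ^ 2) * half_quot (- (of_nat (3 * p) ^ 2 / 16)) m)
       = of_nat p ^ 3 * (15 * (1 / ((of_nat (3 * p) - 1)^2 + of_nat (3 * p) ^ 2)) * (z * prod g ({..<m} - {i})))"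
      unfolding h by (simp add: eval_nat_numeral mult_ac)
    show "15 * (1 / ((of_nat (3 * p) - 1)^2 + of_nat (3 * p) ^ 2)) * (z * prod g ({..<m} - {i})) \<in> p_integral p"
      by (intro p_integral_mult p_integral_numeral p_integral_inverse_sum_squares p_integral_prod p z g) auto
  qed
  then show "rcong p 3 S 0"
    unfolding S_def using sum_rcong_closed_form[OF p m1 mp] rcong_trans[OF p(1)] by (meson dvd_triv_right)
next
  note p = assms(1,3)
  assume "p mod 4 = 3"
  define m where "m = (p + 1) div 4"
  have m1: "4 * m = p + 1" using \<open>p mod 4 = 3\<close> unfolding m_def by presburger
  have mp: "m < p" using m1 p(2) by linarith
  define P where "P = (of_nat p :: rat)"
  define d where "d = (P - 1)^2 + P^2"
  have "\<not> int p dvd 7 * int p - 3"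
  proof
    assume "int p dvd 7 * int p - 3"
    then have "int p dvd 7 * int p - (7 * int p - 3)" by (rule dvd_diff[rotated]) simp
    then show False using zdvd_not_zless[of 3 "int p"] p(2) by simp
  qed
  from p_integral_divide[OF p(1) p_integral_numeral(2)[OF p(1)] this]
  have i7: "1 / (7 * P - 3) \<in> p_integral p" by (simp add: P_def)
  have id: "1 / d \<in> p_integral p" using p_integral_inverse_sum_squares[OF p(1), of p] by (simp add: d_def P_def)
  have "P > 3" using p(2) by (simp add: P_def)
  have "d > 0" unfolding d_def using \<open>P > 3\<close> by (intro add_pos_pos zero_less_power) auto
  have "rcong p 2 (5 / d) (5 * (P - 3) / (7 * P - 3))"
    unfolding rcong_def
  proof
    have "5 / d - 5 * (P - 3) / (7 * P - 3) = 5 * ((7 * P - 3) - (P - 3) * d) / (d * (7 * P - 3))"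
      using \<open>d > 0\<close> \<open>P > 3\<close> by (simp add: field_simps)
    also have "(7 * P - 3) - (P - 3) * d = P^2 * (8 - 2 * P)"
      unfolding d_def by (simp add: power2_eq_square algebra_simps)
    finally show "5 / d - 5 * (P - 3) / (7 * P - 3) = of_nat p ^ 2 * (5 * (8 - 2 * P) * (1 / d) * (1 / (7 * P - 3)))"
      by (simp add: P_def)
    show "5 * (8 - 2 * P) * (1 / d) * (1 / (7 * P - 3)) \<in> p_integral p"
      unfolding P_def using i7 id p(1) by (intro p_integral_mult p_integral_diff p_integral_numeral p_integral_of_nat) (auto simp: P_def)
  qed
  then have "rcong p 2 (half_quot (- (P^2 / 16)) m * (5 / d)) (half_quot 0 m * (5 * (P - 3) / (7 * P - 3)))"
  proof (rule rcong_mult[OF p(1), rotated])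
    show "rcong p 2 (half_quot (- (P^2 / 16)) m) (half_quot 0 m)" "half_quot 0 m \<in> p_integral p"
      unfolding P_def by (rule rcong_half_quot[OF p mp dvd_refl])+
    have "5 * (1 / d) \<in> p_integral p" by (intro p_integral_mult p_integral_numeral p(1) id)
    then show "5 / d \<in> p_integral p" by simp
  qed
  then obtain z where z: "z \<in> p_integral p"
    "half_quot (- (P^2 / 16)) m * (5 / d) - half_quot 0 m * (5 * (P - 3) / (7 * P - 3)) = of_nat p ^ 2 * z"
    unfolding rcong_def by auto
  have "P * (5 / d * half_quot (- (P^2 / 16)) m) - P * (5 * (P - 3) / (7 * P - 3) * half_quot 0 m) =
      P * (half_quot (- (P^2 / 16)) m * (5 / d) - half_quot 0 m * (5 * (P - 3) / (7 * P - 3)))"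
    by (simp add: algebra_simps)
  also have "\<dots> = of_nat p ^ 3 * z" unfolding z(2) by (simp add: P_def eval_nat_numeral)
  finally have "rcong p 3 (P * (5 / d * half_quot (- (P^2 / 16)) m)) (P * (5 * (P - 3) / (7 * P - 3) * half_quot 0 m))"
    unfolding rcong_def using z(1) by blast
  moreover have "half_quot 0 m = pochhammer (1/2) m ^ 2 / fact m ^ 2"
    unfolding half_quot_def pochhammer_fact[of m, where ?'a=rat] pochhammer_prod prod_power_distrib prod_dividef[symmetric]
    by (simp add: atLeast0LessThan add_ac)
  ultimately have "rcong p 3 (P * (5 / d * half_quot (- (P^2 / 16)) m))
      (5 * of_nat p * (of_nat p - 3) * pochhammer (1/2) m ^ 2 / ((7 * of_nat p - 3) * fact m ^ 2))"
    by (simp add: P_def mult_ac)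
  then show "rcong p 3 S (5 * of_nat p * (of_nat p - 3) * pochhammer (1/2) ((p + 1) div 4) ^ 2 /
          ((7 * of_nat p - 3) * fact ((p + 1) div 4) ^ 2))"
    using sum_rcong_closed_form[OF p m1 mp dvd_refl] rcong_trans[OF p(1)]
    unfolding S_def m_def[symmetric] d_def P_def by blast
qed

end
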